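(* Any one-pass streaming algorithm for the $k$-Girth problem on $n$-vertex graphs requires $\Omega(n^2)$ bits of space, even when $k=3$.
   Context: $k$-Girth: given an undirected graph $G$, decide whether the length of a shortest cycle of $G$ equals $k$ (the girth is $\infty$ if $G$ has no cycle). Streaming model: the vertex set is fixed and the edges arrive one by one (the lower bound holds already for insertion-only streams). Lower bounds apply to all algorithms, including randomized ones that answer correctly with constant probability (say at least $2/3$). *)

theory Defs
  imports "HOL-Probability.Probability" "HOL-Library.Landau_Symbols" "HOL-Library.Extended_Nat"
begin

text \<open>
  Simple undirected graphs on the vertex set \<open>{..<n}\<close> are given by their edge sets,
  an edge being a two-element set of vertices.
\<close>

definition all_edges :: "nat \<Rightarrow> nat set set" where
  "all_edges n = {e. e \<subseteq> {..<n} \<and> card e = 2}"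

text \<open>A cycle is the list of its vertices in cyclic order, so its length is the length of the list.\<close>

definition is_cycle :: "'v set set \<Rightarrow> 'v list \<Rightarrow> bool" where
  "is_cycle E c \<longleftrightarrow> length c \<ge> 3 \<and> distinct c \<and>
     (\<forall>i < length c. {c ! i, c ! (Suc i mod length c)} \<in> E)"

text \<open>The infimum of the empty set of extended naturals is \<open>\<infinity>\<close>, so forests have girth \<open>\<infinity>\<close>.\<close>

definition girth :: "'v set set \<Rightarrow> enat" where
  "girth E = (INF c \<in> {c. is_cycle E c}. enat (length c))"

definition k_girth :: "nat \<Rightarrow> 'v set set \<Rightarrow> bool" where
  "k_girth k E \<longleftrightarrow> girth E = enat k"

text \<open>
  A randomized one-pass streaming algorithm over items of type \<open>'e\<close>. Its memory content between
  two items is a bit string. Fresh coins may be tossed initially, when an item is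
  processed, and when the answer is given; in addition a random seed is drawn once at the start
  and can be read at any time without being charged to the memory. Taking a constant seed
  gives the model in which remembered randomness is charged, and taking all
  distributions to be point masses gives the deterministic algorithms. An update is an arbitrary
  (not necessarily computable) kernel, and its working space is not charged.
\<close>

record ('r, 'e) streaming_alg =
  seed :: "'r pmf"
  init :: "'r \<Rightarrow> bool list pmf"
  update :: "'r \<Rightarrow> bool list \<Rightarrow> 'e \<Rightarrow> bool list pmf"
  answer :: "'r \<Rightarrow> bool list \<Rightarrow> bool pmf"

definition memory_after :: "('r, 'e) streaming_alg \<Rightarrow> 'r \<Rightarrow> 'e list \<Rightarrow> bool list pmf" where
  "memory_after A r es =
     foldl (\<lambda>p e. bind_pmf p (\<lambda>\<sigma>. update A r \<sigma> e)) (init A r) es"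

definition result :: "('r, 'e) streaming_alg \<Rightarrow> 'e list \<Rightarrow> bool pmf" where
  "result A es = bind_pmf (seed A) (\<lambda>r. bind_pmf (memory_after A r es) (answer A r))"

definition edge_streams :: "nat \<Rightarrow> nat set list set" where
  "edge_streams n = {es. distinct es \<and> set es \<subseteq> all_edges n}"

text \<open>
  As \<open>edge_streams n\<close> is closed under prefixes, this bounds the memory at every
  moment of a run, for all random choices.
\<close>

definition uses_space :: "('r, nat set) streaming_alg \<Rightarrow> nat \<Rightarrow> nat \<Rightarrow> bool" where
  "uses_space A n s \<longleftrightarrow>
     (\<forall>es \<in> edge_streams n. \<forall>r \<in> set_pmf (seed A). \<forall>\<sigma> \<in> set_pmf (memory_after A r es).
        length \<sigma> \<le> s)"

definition solves_k_girth :: "('r, nat set) streaming_alg \<Rightarrow> nat \<Rightarrow> nat \<Rightarrow> bool" where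
  "solves_k_girth A k n \<longleftrightarrow>
     (\<forall>es \<in> edge_streams n. pmf (result A es) (k_girth k (set es)) \<ge> 2 / 3)"

end

theory Submission
  imports Defs
begin

text \<open>
  The bound is a reduction from the one-way communication problem INDEX. A set \<open>X\<close> of pairs is
  encoded as a bipartite graph on two classes of \<open>m\<close> vertices; joining a fresh vertex to \<open>i\<close> on the
  left and \<open>j\<close> on the right closes a triangle iff \<open>(i, j) \<in> X\<close>. So the memory after the first
  part of the stream is a random access code for \<open>m\<^sup>2\<close> bits.

  For the code bound, let \<open>f \<sigma> X\<close> be the expected number of bits of \<open>X\<close> recovered from memory
  content \<open>\<sigma>\<close>. For fixed \<open>\<sigma>\<close> and \<open>N\<close> bits, the mean of \<open>2 powr f \<sigma> X\<close> over uniform \<open>X\<close> factorises over the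
  bits and is at most \<open>(3/2)^N\<close>. If there are \<open>K\<close> memory contents, the best of them therefore
  recovers, on average over \<open>X\<close>, at most \<open>log 2 (K * (3/2)^N)\<close> bits. This must be at least
  \<open>2/3 * N\<close>, and \<open>2 powr (2/3) > 3/2\<close>. Neither the seed nor the coins need to be fixed.
\<close>

section \<open>Random access codes: a lower bound on the number of memory contents\<close>

lemma exp_mult_ln2_le:
  fixes g :: real
  assumes "0 \<le> g" "g \<le> 1"
  shows "exp (ln 2 * g) \<le> 1 + g"
proof -
  \<comment> \<open>By convexity, the graph of \<open>2 powr g\<close> on [0, 1] lies below its
    chord from (0, 1) to (1, 2).\<close>
  have "exp ((1 - g) *\<^sub>R 0 + g *\<^sub>R ln 2) \<le> (1 - g) * exp 0 + g * exp (ln 2 :: real)"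
    using assms by (intro convex_onD[OF exp_convex]) auto
  then show ?thesis by (simp add: mult.commute algebra_simps)
qed

text \<open>Summing over all \<open>X\<close> a product with one factor per bit expands a product of
  two-term sums. The two guessing probabilities for a bit add up to 1, so the chord bound makes each
  factor at most 2 + 1 = 3.\<close>

lemma sum_Pow_exp_correct_le:
  fixes d :: "'i \<Rightarrow> bool pmf"
  assumes "finite I"
  shows "(\<Sum>X\<in>Pow I. exp (ln 2 * (\<Sum>i\<in>I. pmf (d i) (i \<in> X)))) \<le> 3 ^ card I"
proof -
  have "exp (ln 2 * (\<Sum>i\<in>I. pmf (d i) (i \<in> X))) =
      (\<Prod>i\<in>X. exp (ln 2 * pmf (d i) True)) * (\<Prod>i\<in>I - X. exp (ln 2 * pmf (d i) False))"
    if "X \<in> Pow I" for X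
  proof -
    have "(\<Sum>i\<in>I. pmf (d i) (i \<in> X)) =
        (\<Sum>i\<in>I - X. pmf (d i) (i \<in> X)) + (\<Sum>i\<in>X. pmf (d i) (i \<in> X))"
      using that assms by (intro sum.subset_diff) auto
    then show ?thesis
      using that assms finite_subset[of X I]
      by (simp add: distrib_left exp_add sum_distrib_left exp_sum mult.commute)
  qed
  then have "(\<Sum>X\<in>Pow I. exp (ln 2 * (\<Sum>i\<in>I. pmf (d i) (i \<in> X)))) =
      (\<Prod>i\<in>I. exp (ln 2 * pmf (d i) True) + exp (ln 2 * pmf (d i) False))"
    using assms by (simp add: prod_add)
  also have "\<dots> \<le> (\<Prod>i\<in>I. 3)"
  proof (intro prod_mono conjI)
    fix i
    have "exp (ln 2 * pmf (d i) True) \<le> 1 + pmf (d i) True"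
      "exp (ln 2 * pmf (d i) False) \<le> 1 + pmf (d i) False"
      by (intro exp_mult_ln2_le pmf_nonneg pmf_le_1)+
    moreover have "pmf (d i) True + pmf (d i) False = 1"
      by (simp add: pmf_False_conv_True)
    ultimately show "exp (ln 2 * pmf (d i) True) + exp (ln 2 * pmf (d i) False) \<le> 3"
      by linarith
  qed (simp add: add_nonneg_nonneg)
  finally show ?thesis by simp
qed

lemma private_coin_code_correct_le:
  fixes mem :: "'i set \<Rightarrow> 'm pmf" and dec :: "'m \<Rightarrow> 'i \<Rightarrow> bool pmf"
  assumes I: "finite I" and M: "finite M" and sub: "\<And>X. X \<subseteq> I \<Longrightarrow> set_pmf (mem X) \<subseteq> M"
  shows "ln 2 * (\<Sum>X\<in>Pow I. \<Sum>i\<in>I. pmf (bind_pmf (mem X) (\<lambda>\<sigma>. dec \<sigma> i)) (i \<in> X))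
    \<le> 2 ^ card I * (ln (card M) + card I * ln (3/2))"
proof -
  have "M \<noteq> {}" using sub[of "{}"] set_pmf_not_empty[of "mem {}"] by auto
  then have K: "card M > 0" using M by (simp add: card_gt_0_iff)
  \<comment> \<open>\<open>exp c\<close> bounds the mean over uniform \<open>X\<close> of the sum
    over all memory contents of \<open>exp (ln 2 * f \<sigma> X)\<close>.\<close>
  define c where "c = ln (card M * (3/2) ^ card I)"
  have c: "c = ln (card M) + card I * ln (3/2)"
    using K by (simp add: c_def ln_mult ln_realpow)
  have exp_c: "exp c = card M * (3/2) ^ card I"
    using K by (simp add: c_def)
  define f where "f = (\<lambda>\<sigma> X. \<Sum>i\<in>I. pmf (dec \<sigma> i) (i \<in> X))"
  have "ln 2 * (\<Sum>i\<in>I. pmf (bind_pmf (mem X) (\<lambda>\<sigma>. dec \<sigma> i)) (i \<in> X))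
      \<le> c - 1 + exp (- c) * (\<Sum>\<sigma>\<in>M. exp (ln 2 * f \<sigma> X))" if "X \<in> Pow I" for X
  proof -
    have sX: "set_pmf (mem X) \<subseteq> M" using that sub by auto
    have "(\<Sum>i\<in>I. pmf (bind_pmf (mem X) (\<lambda>\<sigma>. dec \<sigma> i)) (i \<in> X)) =
        (\<Sum>i\<in>I. \<Sum>\<sigma>\<in>M. pmf (mem X) \<sigma> * pmf (dec \<sigma> i) (i \<in> X))"
      unfolding pmf_bind using sX M by (simp add: integral_measure_pmf[where A = M] subset_iff)
    also have "\<dots> = (\<Sum>\<sigma>\<in>M. pmf (mem X) \<sigma> * f \<sigma> X)"
      by (subst sum.swap) (simp add: f_def sum_distrib_left)
    finally have "ln 2 * (\<Sum>i\<in>I. pmf (bind_pmf (mem X) (\<lambda>\<sigma>. dec \<sigma> i)) (i \<in> X)) =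
        (\<Sum>\<sigma>\<in>M. pmf (mem X) \<sigma> * (ln 2 * f \<sigma> X))"
      by (simp add: sum_distrib_left mult.left_commute)
    also have "\<dots> \<le> (\<Sum>\<sigma>\<in>M. pmf (mem X) \<sigma> * (c - 1) + exp (- c) * exp (ln 2 * f \<sigma> X))"
    proof (intro sum_mono)
      fix \<sigma>
      \<comment> \<open>The tangent of \<open>ln\<close> at \<open>exp c\<close>; with this \<open>c\<close>, it replaces Jensen's inequality for the mean over \<open>X\<close>.\<close>
      have "ln 2 * f \<sigma> X \<le> (c - 1) + exp (ln 2 * f \<sigma> X - c)"
        using exp_ge_add_one_self[of "ln 2 * f \<sigma> X - c"] by linarith
      then have "pmf (mem X) \<sigma> * (ln 2 * f \<sigma> X)
          \<le> pmf (mem X) \<sigma> * ((c - 1) + exp (ln 2 * f \<sigma> X - c))"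
        by (intro mult_left_mono) auto
      \<comment> \<open>The weight stays on \<open>c - 1\<close>, where it sums to 1 over
        \<open>M\<close>. Replacing it by 1 before the exponential removes the dependence on
        \<open>mem X\<close>, at the price of the factor \<open>card M\<close>.\<close>
      also have "\<dots> \<le> pmf (mem X) \<sigma> * (c - 1) + 1 * exp (ln 2 * f \<sigma> X - c)"
        unfolding distrib_left by (intro add_left_mono mult_right_mono pmf_le_1) auto
      finally show "pmf (mem X) \<sigma> * (ln 2 * f \<sigma> X)
          \<le> pmf (mem X) \<sigma> * (c - 1) + exp (- c) * exp (ln 2 * f \<sigma> X)"
        by (simp add: exp_diff exp_minus field_simps)
    qed
    also have "\<dots> = c - 1 + exp (- c) * (\<Sum>\<sigma>\<in>M. exp (ln 2 * f \<sigma> X))"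
      using sum_pmf_eq_1[OF M sX]
      by (simp add: sum.distrib sum_distrib_left flip: sum_distrib_right)
    finally show ?thesis .
  qed
  then have "ln 2 * (\<Sum>X\<in>Pow I. \<Sum>i\<in>I. pmf (bind_pmf (mem X) (\<lambda>\<sigma>. dec \<sigma> i)) (i \<in> X))
      \<le> (\<Sum>X\<in>Pow I. c - 1 + exp (- c) * (\<Sum>\<sigma>\<in>M. exp (ln 2 * f \<sigma> X)))"
    unfolding sum_distrib_left[of "ln 2" _ "Pow I"] by (rule sum_mono)
  also have "\<dots> = 2 ^ card I * (c - 1) + exp (- c) * (\<Sum>\<sigma>\<in>M. \<Sum>X\<in>Pow I. exp (ln 2 * f \<sigma> X))"
    by (subst sum.swap) (simp add: sum.distrib sum_distrib_left card_Pow I)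
  also have "\<dots> \<le> 2 ^ card I * (c - 1) + exp (- c) * (\<Sum>\<sigma>\<in>M. 3 ^ card I)"
    unfolding f_def by (intro add_left_mono mult_left_mono sum_mono sum_Pow_exp_correct_le I) auto
  \<comment> \<open>By the choice of \<open>c\<close>, the second summand is exactly
    \<open>2 ^ card I\<close> and cancels the -1.\<close>
  also have "\<dots> = 2 ^ card I * c"
    using K by (simp add: exp_minus exp_c field_simps)
  finally show ?thesis by (simp add: c)
qed

text \<open>The bound for private coins is the same for every seed value, so it survives the
  expectation over the seed, which commutes with the finite sums.\<close>

lemma random_access_code_bound:
  fixes sd :: "'r pmf" and mem :: "'r \<Rightarrow> 'i set \<Rightarrow> 'm pmf" and dec :: "'r \<Rightarrow> 'm \<Rightarrow> 'i \<Rightarrow> bool pmf"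
  assumes I: "finite I" and M: "finite M"
    and sub: "\<And>r X. r \<in> set_pmf sd \<Longrightarrow> X \<subseteq> I \<Longrightarrow> set_pmf (mem r X) \<subseteq> M"
    and correct: "\<And>X i. X \<subseteq> I \<Longrightarrow> i \<in> I \<Longrightarrow>
      pmf (bind_pmf sd (\<lambda>r. bind_pmf (mem r X) (\<lambda>\<sigma>. dec r \<sigma> i))) (i \<in> X) \<ge> p"
  shows "card I * (p * ln 2 - ln (3/2)) \<le> ln (card M)"
proof -
  define a where "a = (\<lambda>X i r. pmf (bind_pmf (mem r X) (\<lambda>\<sigma>. dec r \<sigma> i)) (i \<in> X))"
  have int: "integrable (measure_pmf sd) (a X i)" for X i
    by (rule measure_pmf.integrable_const_bound[where B = 1]) (auto simp: a_def pmf_le_1)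
  have "2 ^ card I * (card I * (p * ln 2)) = ln 2 * (\<Sum>X\<in>Pow I. \<Sum>i\<in>I. p)"
    by (simp add: card_Pow I)
  also have "\<dots> \<le> ln 2 * (\<Sum>X\<in>Pow I. \<Sum>i\<in>I. measure_pmf.expectation sd (a X i))"
    using correct by (intro mult_left_mono sum_mono) (auto simp: a_def pmf_bind)
  also have "\<dots> = measure_pmf.expectation sd (\<lambda>r. ln 2 * (\<Sum>X\<in>Pow I. \<Sum>i\<in>I. a X i r))"
    by (simp add: int)
  also have "\<dots> \<le> 2 ^ card I * (ln (card M) + card I * ln (3/2))"
  proof (rule measure_pmf.integral_le_const)
    show "AE r in measure_pmf sd. ln 2 * (\<Sum>X\<in>Pow I. \<Sum>i\<in>I. a X i r)
        \<le> 2 ^ card I * (ln (card M) + card I * ln (3/2))"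
      unfolding a_def using I M sub
      by (auto simp: AE_measure_pmf_iff intro!: private_coin_code_correct_le)
  qed (simp add: int)
  finally show ?thesis by (simp add: right_diff_distrib)
qed

section \<open>Memory contents and splitting a run\<close>

lemma card_bool_lists_length_le:
  "finite {xs :: bool list. length xs \<le> s}" "card {xs :: bool list. length xs \<le> s} \<le> 2 ^ Suc s"
proof -
  show "finite {xs :: bool list. length xs \<le> s}"
    using finite_lists_length_le[of "UNIV :: bool set" s] by simp
  have "(\<Sum>i\<le>s. 2 ^ i) \<le> (2 ^ Suc s :: nat)" by (induction s) auto
  then show "card {xs :: bool list. length xs \<le> s} \<le> 2 ^ Suc s"
    using card_lists_length_le[of "UNIV :: bool set" s] by simp
qed

text \<open>This cuts a run at the moment between encoder and decoder: given the seed, the rest of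
  the run depends on \<open>xs\<close> only through the memory content.\<close>

lemma memory_after_append:
  "memory_after A r (xs @ ys) = bind_pmf (memory_after A r xs)
     (\<lambda>\<sigma>. foldl (\<lambda>p e. bind_pmf p (\<lambda>\<sigma>. update A r \<sigma> e)) (return_pmf \<sigma>) ys)"
proof (induction ys rule: rev_induct)
  case Nil
  then show ?case by (simp add: bind_return_pmf')
next
  case (snoc y ys)
  then show ?case by (simp add: memory_after_def bind_assoc_pmf flip: append_assoc)
qed

section \<open>Triangles in the query graph\<close>

text \<open>No cycle is shorter than 3, so a triangle attains the infimum. Without triangles all
  lengths are at least 4, hence so is the infimum, also when it is infinite.\<close>

lemma k_girth_3_iff:
  "k_girth 3 E \<longleftrightarrow> (\<exists>a b c. distinct [a, b, c] \<and> {a, b} \<in> E \<and> {b, c} \<in> E \<and> {c, a} \<in> E)"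
proof -
  have cyc: "is_cycle E [a, b, c] \<longleftrightarrow>
      distinct [a, b, c] \<and> {a, b} \<in> E \<and> {b, c} \<in> E \<and> {c, a} \<in> E" for a b c
    by (simp add: is_cycle_def All_less_Suc) blast
  have "girth E = enat 3 \<longleftrightarrow> (\<exists>c. is_cycle E c \<and> length c = 3)"
  proof
    assume g: "girth E = enat 3"
    show "\<exists>c. is_cycle E c \<and> length c = 3"
    proof (rule ccontr)
      assume none: "\<not> ?thesis"
      have "enat 4 \<le> enat (length c)" if "is_cycle E c" for c
      proof -
        have "length c \<ge> 3" using that by (simp add: is_cycle_def)
        moreover have "length c \<noteq> 3" using that none by blast
        ultimately show ?thesis by simp
      qed
      then have "enat 4 \<le> girth E" unfolding girth_def by (intro INF_greatest) auto
      then show False by (simp add: g)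
    qed
  next
    assume "\<exists>c. is_cycle E c \<and> length c = 3"
    then obtain c where c: "is_cycle E c" "length c = 3" by blast
    have "girth E \<le> enat (length c)" unfolding girth_def using c(1) by (intro INF_lower) auto
    moreover have "enat 3 \<le> girth E"
      unfolding girth_def by (intro INF_greatest) (auto simp: is_cycle_def)
    ultimately show "girth E = enat 3" using c(2) by simp
  qed
  also have "\<dots> \<longleftrightarrow> (\<exists>a b c. is_cycle E [a, b, c])"
  proof -
    have "length c = 3 \<longleftrightarrow> (\<exists>x y z. c = [x, y, z])" for c :: "'a list"
      by (auto simp: numeral_3_eq_3 length_Suc_conv)
    then show ?thesis by (auto simp del: length_Cons)
  qed
  finally show ?thesis by (simp add: k_girth_def cyc)
qed

definition bip_graph :: "nat \<Rightarrow> (nat \<times> nat) set \<Rightarrow> nat set set" where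
  "bip_graph m X = (\<lambda>(i, j). {i, m + j}) ` X"

text \<open>The classes occupy \<open>{..<m}\<close> and \<open>{m..<2 * m}\<close>, so
  \<open>2 * m\<close> is the first fresh vertex.\<close>

definition query_stream :: "nat \<Rightarrow> nat \<times> nat \<Rightarrow> nat set list" where
  "query_stream m q = [{fst q, 2 * m}, {m + snd q, 2 * m}]"

lemma k_girth_3_query:
  assumes X: "X \<subseteq> {..<m} \<times> {..<m}" and ij: "i < m" "j < m"
  shows "k_girth 3 (bip_graph m X \<union> set (query_stream m (i, j))) \<longleftrightarrow> (i, j) \<in> X"
proof -
  define E where "E = bip_graph m X \<union> set (query_stream m (i, j))"
  have bnd: "a < m \<and> b < m" if "(a, b) \<in> X" for a b
    using that X by auto
  \<comment> \<open>Ordering the endpoints tells left from right. The guard \<open>m \<le> v\<close>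
    excludes truncated subtraction, which would turn \<open>v - m\<close> into 0.\<close>
  have edge: "{u, v} \<in> E \<longleftrightarrow> (u, v - m) \<in> X \<and> m \<le> v \<or> v = 2 * m \<and> (u = i \<or> u = m + j)"
    if "u < v" for u v
  proof
    assume "{u, v} \<in> E"
    then consider a b where "(a, b) \<in> X" "{u, v} = {a, m + b}"
      | "{u, v} = {i, 2 * m}" | "{u, v} = {m + j, 2 * m}"
      by (auto simp: E_def bip_graph_def query_stream_def)
    then show "(u, v - m) \<in> X \<and> m \<le> v \<or> v = 2 * m \<and> (u = i \<or> u = m + j)"
    proof cases
      case 1
      then have "u = a \<and> v = m + b" using bnd[of a b] that by (auto simp: doubleton_eq_iff)
      then show ?thesis using 1 by simp
    qed (use that ij in \<open>auto simp: doubleton_eq_iff\<close>)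
  next
    assume "(u, v - m) \<in> X \<and> m \<le> v \<or> v = 2 * m \<and> (u = i \<or> u = m + j)"
    then consider "(u, v - m) \<in> X" "m \<le> v" | "v = 2 * m" "u = i \<or> u = m + j" by blast
    then show "{u, v} \<in> E"
    proof cases
      case 1
      then have "{u, v} \<in> bip_graph m X"
        unfolding bip_graph_def by (intro image_eqI[of _ _ "(u, v - m)"]) auto
      then show ?thesis by (simp add: E_def)
    qed (auto simp: E_def query_stream_def)
  qed
  have "(\<exists>a b c. distinct [a, b, c] \<and> {a, b} \<in> E \<and> {b, c} \<in> E \<and> {c, a} \<in> E) \<longleftrightarrow>
      (\<exists>a b c. a < b \<and> b < c \<and> {a, b} \<in> E \<and> {b, c} \<in> E \<and> {a, c} \<in> E)" (is "?L \<longleftrightarrow> ?R")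
  proof
    assume ?L
    then obtain a b c where *: "distinct [a, b, c]" "{a, b} \<in> E" "{b, c} \<in> E" "{c, a} \<in> E" by blast
    have **: "{b, a} \<in> E" "{c, b} \<in> E" "{a, c} \<in> E" using * by (simp_all add: insert_commute)
    consider "a < b \<and> b < c" | "a < c \<and> c < b" | "b < a \<and> a < c" | "b < c \<and> c < a"
      | "c < a \<and> a < b" | "c < b \<and> b < a" using *(1) by force
    then show ?R using * ** by cases blast+
  next
    assume ?R
    then obtain a b c where "a < b" "b < c" "{a, b} \<in> E" "{b, c} \<in> E" "{a, c} \<in> E" by blast
    then show ?L by (intro exI[of _ a] exI[of _ b] exI[of _ c]) (auto simp: insert_commute)
  qed
  also have "\<dots> \<longleftrightarrow> (i, j) \<in> X"
  proof
    assume ?R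
    then obtain a b c where t: "a < b" "b < c" "{a, b} \<in> E" "{b, c} \<in> E" "{a, c} \<in> E" by blast
    \<comment> \<open>The middle vertex is the upper end of one edge and the lower end of another,
      which forces it into the right class. The only possible larger neighbour there is
      \<open>2 * m\<close>, and only for \<open>m + j\<close>; the smallest vertex must then be
      \<open>i\<close>.\<close>
    have b: "m \<le> b" "b < 2 * m" using edge[of a b] edge[of b c] t bnd[of a "b - m"] bnd[of b "c - m"] ij by linarith+
    then have "c = 2 * m" "b = m + j" using edge[of b c] t bnd[of b "c - m"] ij by linarith+
    moreover from this b have "a = i" using edge[of a c] t bnd[of a "c - m"] ij by linarith
    ultimately show "(i, j) \<in> X" using edge[of a b] t ij by auto
  next
    assume "(i, j) \<in> X"
    then show ?R using edge ij by (intro exI[of _ i] exI[of _ "m + j"] exI[of _ "2 * m"]) auto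
  qed
  finally show ?thesis by (simp add: k_girth_3_iff E_def)
qed

section \<open>The reduction and the asymptotic bound\<close>

lemma append_query_in_edge_streams:
  assumes X: "X \<subseteq> {..<m} \<times> {..<m}" and q: "q \<in> {..<m} \<times> {..<m}" and n: "2 * m < n"
    and es: "distinct es" "set es = bip_graph m X"
  shows "es @ query_stream m q \<in> edge_streams n" "es \<in> edge_streams n"
proof -
  have "set es \<subseteq> all_edges n"
  proof
    fix e assume "e \<in> set es"
    then obtain i j where e: "e = {i, m + j}" "i < m" "j < m" using X by (auto simp: es bip_graph_def)
    then have "i \<noteq> m + j" by simp
    then show "e \<in> all_edges n" using e n by (auto simp: all_edges_def)
  qed
  moreover have "set (query_stream m q) \<subseteq> all_edges n"
    using q n by (auto simp: query_stream_def all_edges_def)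
  moreover have "distinct (query_stream m q)"
    using q by (auto simp: query_stream_def doubleton_eq_iff)
  moreover have "bip_graph m X \<inter> set (query_stream m q) = {}"
    using X q by (auto simp: query_stream_def bip_graph_def doubleton_eq_iff)
  ultimately show "es @ query_stream m q \<in> edge_streams n" "es \<in> edge_streams n"
    using es by (auto simp: edge_streams_def)
qed

lemma k_girth_3_space_bound:
  assumes sol: "solves_k_girth A 3 n" and sp: "uses_space A n s" and n: "2 * m < n"
  shows "(real m)\<^sup>2 * (2/3 * ln 2 - ln (3/2)) \<le> (real s + 1) * ln 2"
proof -
  define I where "I = {..<m} \<times> {..<m}"
  define M where "M = {xs :: bool list. length xs \<le> s}"
  have "\<exists>es. distinct es \<and> set es = bip_graph m X" if "X \<subseteq> I" for X
  proof -
    have "finite X" using that finite_subset[of X I] by (simp add: I_def)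
    then have "finite (bip_graph m X)" by (simp add: bip_graph_def)
    then show ?thesis using finite_distinct_list by metis
  qed
  then obtain enc where enc: "\<And>X. X \<subseteq> I \<Longrightarrow> distinct (enc X) \<and> set (enc X) = bip_graph m X"
    by metis
  \<comment> \<open>The decoder resumes the algorithm from \<sigma> with the same seed, feeds it the
    two query edges and returns its answer.\<close>
  define dec where "dec = (\<lambda>r \<sigma> q.
    bind_pmf (foldl (\<lambda>p e. bind_pmf p (\<lambda>\<sigma>. update A r \<sigma> e)) (return_pmf \<sigma>) (query_stream m q))
      (answer A r))"
  have "card I * (2/3 * ln 2 - ln (3/2)) \<le> ln (card M)"
  proof (rule random_access_code_bound[where sd = "seed A" and dec = dec
        and mem = "\<lambda>r X. memory_after A r (enc X)"])
    show "finite I" "finite M" by (simp_all add: I_def M_def card_bool_lists_length_le)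
    show "set_pmf (memory_after A r (enc X)) \<subseteq> M" if r: "r \<in> set_pmf (seed A)" and X: "X \<subseteq> I" for r X
    \<comment> \<open>\<open>append_query_in_edge_streams\<close> asks for some query
      \<open>q\<close>, and there is none when \<open>m = 0\<close>; the stream is then
      empty.\<close>
    proof (cases "I = {}")
      case True
      then have "enc X = []" using enc[OF X] X by (simp add: bip_graph_def)
      then have "enc X \<in> edge_streams n" by (simp add: edge_streams_def)
      then show ?thesis using sp r unfolding uses_space_def M_def by auto
    next
      case False
      then have "enc X \<in> edge_streams n"
        using append_query_in_edge_streams(2)[of X m _ n] X enc[OF X] n unfolding I_def by blast
      then show ?thesis using sp r unfolding uses_space_def M_def by auto
    qed
    show "pmf (bind_pmf (seed A) (\<lambda>r. bind_pmf (memory_after A r (enc X)) (\<lambda>\<sigma>. dec r \<sigma> q))) (q \<in> X)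
        \<ge> 2/3" if X: "X \<subseteq> I" and q: "q \<in> I" for X q
    proof -
      have "enc X @ query_stream m q \<in> edge_streams n"
        using append_query_in_edge_streams(1) X q enc[OF X] n unfolding I_def by blast
      then have "pmf (result A (enc X @ query_stream m q))
          (k_girth 3 (set (enc X @ query_stream m q))) \<ge> 2/3"
        using sol unfolding solves_k_girth_def by blast
      moreover have "k_girth 3 (set (enc X @ query_stream m q)) \<longleftrightarrow> q \<in> X"
        using k_girth_3_query[of X m "fst q" "snd q"] X q enc[OF X] by (auto simp: I_def)
      moreover have "result A (enc X @ query_stream m q) =
          bind_pmf (seed A) (\<lambda>r. bind_pmf (memory_after A r (enc X)) (\<lambda>\<sigma>. dec r \<sigma> q))"
        by (simp add: result_def memory_after_append dec_def bind_assoc_pmf)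
      ultimately show ?thesis by (simp only:)
    qed
  qed
  also have "ln (card M) \<le> ln (2 ^ Suc s)"
  proof -
    have "[] \<in> M" by (simp add: M_def)
    moreover have "finite M" unfolding M_def by (rule card_bool_lists_length_le)
    ultimately have "card M > 0" by (auto simp: card_gt_0_iff)
    moreover have "real (card M) \<le> real (2 ^ Suc s)"
      using card_bool_lists_length_le(2)[of s] unfolding M_def by (rule of_nat_mono)
    ultimately show ?thesis by simp
  qed
  also have "\<dots> = (real s + 1) * ln 2" by (subst ln_realpow) auto
  finally show ?thesis by (simp add: I_def power2_eq_square)
qed

lemma k_girth_3_space_bigomega:
  assumes "\<And>n. solves_k_girth (B n) 3 n \<and> uses_space (B n) n (T n)"
  shows "(\<lambda>n. real (T n)) \<in> \<Omega>(\<lambda>n. (real n)\<^sup>2)"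
proof -
  \<comment> \<open>The 16 is the square of the loss in \<open>n \<le> 4 * m\<close>;
    \<open>ln 2\<close> converts to bits.\<close>
  define c :: real where "c = (2/3 * ln 2 - ln (3/2)) / (16 * ln 2)"
  \<comment> \<open>The gap is positive because 27/8 < 4.\<close>
  have "ln ((3/2) ^ 3) = 3 * ln (3/2 :: real)" "ln (2 ^ 2) = 2 * ln (2 :: real)"
    by (subst ln_realpow; simp)+
  moreover have "ln ((3/2) ^ 3) < ln ((2::real) ^ 2)"
    by (subst ln_less_cancel_iff) (auto simp: power_divide)
  ultimately have gap: "0 < 2/3 * ln 2 - ln (3/2 :: real)" by linarith
  then have c: "c > 0" by (simp add: c_def)
  have bound: "c * (real n)\<^sup>2 \<le> real (T n) + 1" if "n \<ge> 4" for n
  proof -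
    define m where "m = (n - 1) div 2"
    have m: "2 * m < n" "n \<le> 4 * m" using that by (auto simp: m_def)
    have "real n / 4 \<le> real m" using m(2) by linarith
    then have "(real n / 4)\<^sup>2 \<le> (real m)\<^sup>2" by (intro power_mono) auto
    then have "(real n / 4)\<^sup>2 * (2/3 * ln 2 - ln (3/2)) \<le> (real m)\<^sup>2 * (2/3 * ln 2 - ln (3/2))"
      using gap by (intro mult_right_mono) auto
    also have "\<dots> \<le> (real (T n) + 1) * ln 2"
      using k_girth_3_space_bound assms m(1) by blast
    finally have "(real n / 4)\<^sup>2 * (2/3 * ln 2 - ln (3/2)) / ln 2 \<le> real (T n) + 1"
      by (subst pos_divide_le_eq) auto
    then show ?thesis by (simp add: c_def power_divide mult.commute)
  qed
  show ?thesis
  proof (rule landau_omega.bigI)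
    show "c / 2 > 0" using c by simp
    show "\<forall>\<^sub>F n in sequentially. c / 2 * norm ((real n)\<^sup>2) \<le> norm (real (T n))"
    proof (rule eventually_sequentiallyI)
      \<comment> \<open>Beyond \<open>2 / c\<close>, the term \<open>c * n^2\<close> is at least 2,
        so half of it absorbs the +1 in \<open>bound\<close>.\<close>
      fix n assume n: "max 4 (nat \<lceil>2 / c\<rceil>) \<le> n"
      have "2 / c \<le> real n" using n by linarith
      also have "\<dots> \<le> (real n)\<^sup>2" using n by (simp add: power2_eq_square)
      finally have "2 \<le> c * (real n)\<^sup>2" using c by (simp add: field_simps)
      then show "c / 2 * norm ((real n)\<^sup>2) \<le> norm (real (T n))" using bound[of n] n by simp
    qed
  qed
qed

text \<open>A family for all \<open>k\<close> contains one for \<open>k = 3\<close> with the same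
  space function, so both conjuncts follow from the triangle case.\<close>

theorem theorem29:
  fixes A :: "nat \<Rightarrow> nat \<Rightarrow> ('r, nat set) streaming_alg"
    and B :: "nat \<Rightarrow> ('r, nat set) streaming_alg"
    and S T :: "nat \<Rightarrow> nat"
  shows
    "((\<forall>n. \<forall>k\<ge>3. solves_k_girth (A k n) k n \<and> uses_space (A k n) n (S n))
        \<longrightarrow> (\<lambda>n. real (S n)) \<in> \<Omega>(\<lambda>n. (real n)\<^sup>2)) \<and>
     ((\<forall>n. solves_k_girth (B n) 3 n \<and> uses_space (B n) n (T n))
        \<longrightarrow> (\<lambda>n. real (T n)) \<in> \<Omega>(\<lambda>n. (real n)\<^sup>2))"
  using k_girth_3_space_bigomega[of "A 3" S] k_girth_3_space_bigomega[of B T] by simp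

end
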